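(* Let $G=(V,E)$ be a finite simple graph with non-negative edge weights $w=(w_{ij})_{ij\in E}$, and $Z(w)=\sum_{\mathcal M\text{ perfect matching}}\prod_{ij\in\mathcal M}w_{ij}$. Let $v=(v_{ij})$ be an LBP solution with Bethe approximation $Z_B$, as in the context. Then $$Z(w)=Z_B\sum_{s\subset E}\ \prod_{i\in V}\big(1-d_i(s)\big)\prod_{ij\in s}\frac{v_{ij}}{1-v_{ij}},$$ where $d_i(s)$ is the number of edges of $s$ incident to $i$.
   Context: $L'=\{v\in\mathbb{R}^E: v_{ij}>0,\ \sum_{j\in N_i}v_{ij}=1\ \forall i\in V\}$ ($N_i$ the neighbours of $i$). An LBP solution is $v\in L'$ for which there exist $(\mu_i)_{i\in V}$ with $v_{ij}(1-v_{ij})=w_{ij}e^{\mu_i+\mu_j}$ for all $ij\in E$ (the stationary points of the Bethe free energy). The Bethe free energy is $F(v)=-\sum_{ij\in E}v_{ij}\log w_{ij}+\sum_{ij\in E}\{v_{ij}\log v_{ij}-(1-v_{ij})\log(1-v_{ij})\}$ and $Z_B=e^{-F(v)}$. *)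

theory Defs
  imports "HOL-Analysis.Analysis" "HOL-Library.Ramsey"
begin

(* Edges are two-element vertex sets; nsets V 2 is the set of all of them. *)
definition finite_simple_graph :: "'a set \<Rightarrow> 'a set set \<Rightarrow> bool" where
  "finite_simple_graph V E \<longleftrightarrow> finite V \<and> E \<subseteq> nsets V 2"

definition neighbours :: "'a set \<Rightarrow> 'a set set \<Rightarrow> 'a \<Rightarrow> 'a set" where
  "neighbours V E i = {j \<in> V. {i, j} \<in> E}"

definition perfect_matching :: "'a set \<Rightarrow> 'a set set \<Rightarrow> 'a set set \<Rightarrow> bool" where
  "perfect_matching V E M \<longleftrightarrow> M \<subseteq> E \<and> (\<forall>i\<in>V. \<exists>!e. e \<in> M \<and> i \<in> e)"

definition partition_function :: "'a set \<Rightarrow> 'a set set \<Rightarrow> ('a set \<Rightarrow> real) \<Rightarrow> real" where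
  "partition_function V E w = (\<Sum>M\<in>{M. perfect_matching V E M}. \<Prod>e\<in>M. w e)"

(* A vector in R^E is a function on vertex sets of which only the values on E matter. *)
definition L' :: "'a set \<Rightarrow> 'a set set \<Rightarrow> ('a set \<Rightarrow> real) set" where
  "L' V E = {v. (\<forall>e\<in>E. v e > 0) \<and> (\<forall>i\<in>V. (\<Sum>j\<in>neighbours V E i. v {i, j}) = 1)}"

definition LBP_solution ::
  "'a set \<Rightarrow> 'a set set \<Rightarrow> ('a set \<Rightarrow> real) \<Rightarrow> ('a set \<Rightarrow> real) \<Rightarrow> bool" where
  "LBP_solution V E w v \<longleftrightarrow> v \<in> L' V E \<and>
     (\<exists>\<mu> :: 'a \<Rightarrow> real. \<forall>i j. {i, j} \<in> E \<longrightarrow>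
        v {i, j} * (1 - v {i, j}) = w {i, j} * exp (\<mu> i + \<mu> j))"

(* Zero weights are allowed, and an LBP solution has v = 1, w = 0 on an edge that is a whole
   connected component.  There F = \<infinity> and Z_B = 0, so log and exp are taken with the
   conventions log 0 = -\<infinity>, exp (-\<infinity>) = 0, exp \<infinity> = \<infinity>.
   (The library's real ln has ln 0 = 0.) *)
definition log_ext :: "real \<Rightarrow> ereal" where
  "log_ext x = (if x = 0 then -\<infinity> else ereal (ln x))"

definition exp_ext :: "ereal \<Rightarrow> ereal" where
  "exp_ext x = (case x of ereal r \<Rightarrow> ereal (exp r) | PInfty \<Rightarrow> \<infinity> | MInfty \<Rightarrow> 0)"

(* In the second sum ln 0 only occurs multiplied by 0, which is the convention 0 log 0 = 0. *)
definition bethe_free_energy :: "'a set set \<Rightarrow> ('a set \<Rightarrow> real) \<Rightarrow> ('a set \<Rightarrow> real) \<Rightarrow> ereal" where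
  "bethe_free_energy E w v =
     - (\<Sum>e\<in>E. ereal (v e) * log_ext (w e))
     + ereal (\<Sum>e\<in>E. v e * ln (v e) - (1 - v e) * ln (1 - v e))"

definition Z_B :: "'a set set \<Rightarrow> ('a set \<Rightarrow> real) \<Rightarrow> ('a set \<Rightarrow> real) \<Rightarrow> ereal" where
  "Z_B E w v = exp_ext (- bethe_free_energy E w v)"

definition degree_in :: "'a set set \<Rightarrow> 'a \<Rightarrow> nat" where
  "degree_in s i = card {e \<in> s. i \<in> e}"

(* Where v e = 1 the quotient is 1 / 0 = 0.  Its value is immaterial: such an edge e = {i, j}
   is the only edge at i, so any s containing e has the vertex factor 1 - d_i(s) = 0. *)
definition loop_sum :: "'a set \<Rightarrow> 'a set set \<Rightarrow> ('a set \<Rightarrow> real) \<Rightarrow> real" where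
  "loop_sum V E v =
     (\<Sum>s\<in>Pow E. (\<Prod>i\<in>V. 1 - real (degree_in s i)) * (\<Prod>e\<in>s. v e / (1 - v e)))"

end

theory Submission
  imports Defs
begin

text \<open>
  Write the loop sum, multiplied by \<open>\<Prod>e. 1 - v e\<close>, as the expectation of \<open>\<Prod>i. 1 - d\<^sub>i(s)\<close>
  over a random edge set \<open>s\<close> containing each edge \<open>e\<close> independently with probability \<open>v e\<close>.
  Since the \<open>v e\<close> around a vertex sum to one, \<open>1 - d\<^sub>i(s)\<close> is the sum of the centred variables
  \<open>v e - [e \<in> s]\<close> over the edges at \<open>i\<close>. Expanding the product gives a sum over the choices \<open>f\<close>
  of an edge at every vertex; an edge chosen by exactly one of its ends contributes
  the factor zero, and an edge chosen by both ends contributes its variance \<open>v e (1 - v e)\<close>.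
  What remains is a sum over perfect matchings, and the stationarity equation turns
  \<open>v e (1 - v e)\<close> into \<open>w e\<close>.
\<close>

section \<open>Edge-subset expansion and incidence sums\<close>

text \<open>This serves as the independence of the edges: a sum over random edge sets of a product
  of per-edge terms factors into one two-term sum per edge.\<close>

lemma sum_Pow_prod_add:
  fixes f g :: "'e \<Rightarrow> 'c::comm_semiring_1"
  assumes "finite E"
  shows "(\<Sum>s\<in>Pow E. \<Prod>e\<in>E. if e \<in> s then f e else g e) = (\<Prod>e\<in>E. f e + g e)"
  unfolding prod_add[OF assms]
proof (rule sum.cong[OF refl])
  fix s assume "s \<in> Pow E"
  hence "E \<inter> {e. e \<in> s} = s" "E \<inter> - {e. e \<in> s} = E - s" by auto
  thus "(\<Prod>e\<in>E. if e \<in> s then f e else g e) = prod f s * prod g (E - s)"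
    using assms by (simp only: prod.If_cases)
qed

lemma
  assumes "finite_simple_graph V E"
  shows finite_vertices: "finite V"
    and finite_edges: "finite E"
    and edge_subset: "e \<in> E \<Longrightarrow> e \<subseteq> V"
    and card_edge: "e \<in> E \<Longrightarrow> card e = 2"
    and finite_edge: "e \<in> E \<Longrightarrow> finite e"
proof -
  show V: "finite V" using assms by (simp add: finite_simple_graph_def)
  show "e \<in> E \<Longrightarrow> e \<subseteq> V" "e \<in> E \<Longrightarrow> card e = 2" "e \<in> E \<Longrightarrow> finite e"
    using assms by (auto simp: finite_simple_graph_def nsets_def)
  have "E \<subseteq> Pow V" using assms by (auto simp: finite_simple_graph_def nsets_def)
  thus "finite E" using V by (meson finite_Pow_iff finite_subset)
qed

lemma sum_neighbours:
  assumes "finite_simple_graph V E"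
  shows "(\<Sum>j\<in>neighbours V E i. v {i, j}) = (\<Sum>e\<in>{e\<in>E. i \<in> e}. v e)"
proof -
  have img: "(\<lambda>j. {i, j}) ` neighbours V E i = {e\<in>E. i \<in> e}"
  proof (intro equalityI subsetI)
    fix e assume e: "e \<in> {e\<in>E. i \<in> e}"
    then obtain j where "e = {i, j}"
      using card_edge[OF assms, of e] by (auto simp: card_2_iff)
    then show "e \<in> (\<lambda>j. {i, j}) ` neighbours V E i"
      using e edge_subset[OF assms, of e] by (auto simp: neighbours_def)
  qed (auto simp: neighbours_def)
  have "inj_on (\<lambda>j. {i, j}) (neighbours V E i)"
    by (auto simp: inj_on_def doubleton_eq_iff)
  from sum.reindex[OF this, of v] show ?thesis
    unfolding img by (simp add: o_def)
qed

text \<open>Double counting of incident pairs \<open>i \<in> e\<close>. With \<open>c = v\<close> it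
  evaluates the \<open>\<mu>\<close> part of the Bethe exponent, with \<open>c = 1\<close> the
  \<open>\<mu>\<close> part of a matching weight.\<close>

lemma sum_edges_vertices_swap:
  fixes c :: "'a set \<Rightarrow> real"
  assumes "finite_simple_graph V E"
  shows "(\<Sum>e\<in>E. c e * (\<Sum>i\<in>e. \<mu> i)) = (\<Sum>i\<in>V. \<mu> i * (\<Sum>e\<in>{e\<in>E. i \<in> e}. c e))"
proof -
  have "(\<Sum>e\<in>E. c e * (\<Sum>i\<in>e. \<mu> i)) = (\<Sum>e\<in>E. \<Sum>i\<in>{i\<in>V. i \<in> e}. c e * \<mu> i)"
  proof (rule sum.cong[OF refl])
    fix e assume "e \<in> E"
    hence "{i\<in>V. i \<in> e} = e" using edge_subset[OF assms] by auto
    thus "c e * (\<Sum>i\<in>e. \<mu> i) = (\<Sum>i\<in>{i\<in>V. i \<in> e}. c e * \<mu> i)"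
      by (simp add: sum_distrib_left)
  qed
  also have "\<dots> = (\<Sum>i\<in>V. \<Sum>e\<in>{e\<in>E. i \<in> e}. c e * \<mu> i)"
    by (rule sum.swap_restrict[OF finite_edges[OF assms] finite_vertices[OF assms]])
  finally show ?thesis by (simp add: sum_distrib_left mult.commute)
qed

lemma sum_perfect_matching:
  fixes \<mu> :: "'a \<Rightarrow> real"
  assumes G: "finite_simple_graph V E" and M: "perfect_matching V E M"
  shows "(\<Sum>e\<in>M. \<Sum>i\<in>e. \<mu> i) = (\<Sum>i\<in>V. \<mu> i)"
proof -
  have ME: "M \<subseteq> E" and ex1: "\<And>i. i \<in> V \<Longrightarrow> \<exists>!e. e \<in> M \<and> i \<in> e"
    using M by (simp_all add: perfect_matching_def)
  \<comment> \<open>Double counting is applied to \<open>M\<close> itself as an edge set on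
    \<open>V\<close>, where every vertex has degree one.\<close>
  have GM: "finite_simple_graph V M"
    using G ME by (auto simp: finite_simple_graph_def)
  have "(\<Sum>e\<in>{e\<in>M. i \<in> e}. 1) = (1::real)" if i: "i \<in> V" for i
  proof -
    obtain e where "{e\<in>M. i \<in> e} = {e}"
      using ex1[OF i] by blast
    thus ?thesis by simp
  qed
  thus ?thesis
    using sum_edges_vertices_swap[OF GM, of "\<lambda>_. 1" \<mu>] by (simp del: sum_constant)
qed

section \<open>Perfect matchings as vertex choices\<close>

text \<open>If both ends of every chosen edge agree on it, the chosen edges are pairwise disjoint
  and cover \<open>V\<close>. Conversely, a perfect matching determines the choice of the unique
  matching edge at each vertex.\<close>

lemma perfect_matching_choice_bij:
  assumes G: "finite_simple_graph V E"
  shows "(\<Sum>f\<in>{f \<in> (\<Pi>\<^sub>E i\<in>V. {e\<in>E. i \<in> e}). \<forall>i\<in>V. \<forall>j\<in>f i. f j = f i}. h (f ` V))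
       = (\<Sum>M\<in>{M. perfect_matching V E M}. h M)"
\<comment> \<open>The inverse is restricted to \<open>V\<close> so that it is extensional, as
  membership in \<open>PiE\<close> demands.\<close>
proof (rule sum.reindex_bij_witness
    [where j = "\<lambda>f. f ` V" and i = "\<lambda>M. \<lambda>i\<in>V. THE e. e \<in> M \<and> i \<in> e"])
  fix f assume f: "f \<in> {f \<in> (\<Pi>\<^sub>E i\<in>V. {e\<in>E. i \<in> e}). \<forall>i\<in>V. \<forall>j\<in>f i. f j = f i}"
  hence fP: "f \<in> (\<Pi>\<^sub>E i\<in>V. {e\<in>E. i \<in> e})" and eq: "\<And>i j. i \<in> V \<Longrightarrow> j \<in> f i \<Longrightarrow> f j = f i"
    by blast+
  have fi: "f i \<in> E" "i \<in> f i" if "i \<in> V" for i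
    using PiE_mem[OF fP that] by auto
  have f_undefined: "f i = undefined" if "i \<notin> V" for i
    using PiE_arb[OF fP that] .
  have the: "(THE e. e \<in> f ` V \<and> i \<in> e) = f i" if "i \<in> V" for i
    using that fi eq by (intro the_equality) blast+
  show "(\<lambda>i\<in>V. THE e. e \<in> f ` V \<and> i \<in> e) = f"
    by (rule ext) (simp add: the f_undefined)
  have "\<exists>!e. e \<in> f ` V \<and> i \<in> e" if "i \<in> V" for i
    using that fi eq by (intro ex1I[of _ "f i"]) blast+
  thus "f ` V \<in> {M. perfect_matching V E M}"
    using fi by (auto simp: perfect_matching_def)
next
  fix M assume "M \<in> {M. perfect_matching V E M}"
  hence ME: "M \<subseteq> E" and ex1: "\<And>i. i \<in> V \<Longrightarrow> \<exists>!e. e \<in> M \<and> i \<in> e"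
    by (auto simp: perfect_matching_def)
  define m where "m = (\<lambda>i\<in>V. THE e. e \<in> M \<and> i \<in> e)"
  have m: "m i \<in> M" "i \<in> m i" if "i \<in> V" for i
    using theI'[OF ex1[OF that]] that by (auto simp: m_def)
  have meq: "m i = e" if "e \<in> M" "i \<in> e" for i e
  proof -
    have "i \<in> V" using that edge_subset[OF G] ME by blast
    from ex1[OF this] m[OF this] that show ?thesis by blast
  qed
  have "m ` V = M"
  proof (intro equalityI subsetI)
    fix e assume e: "e \<in> M"
    hence eE: "e \<in> E" using ME by blast
    then obtain i where i: "i \<in> e"
      using card_edge[OF G eE] by (auto simp: card_2_iff)
    hence "i \<in> V" using edge_subset[OF G eE] by blast
    thus "e \<in> m ` V" using meq[OF e i] by blast
  qed (use m in auto)
  thus "(\<lambda>i\<in>V. THE e. e \<in> M \<and> i \<in> e) ` V = M"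
    by (simp add: m_def)
  have "m \<in> (\<Pi>\<^sub>E i\<in>V. {e\<in>E. i \<in> e})"
    using m ME by (auto simp: m_def)
  moreover have "\<forall>i\<in>V. \<forall>j\<in>m i. m j = m i"
    by (intro ballI meq m)
  ultimately show "(\<lambda>i\<in>V. THE e. e \<in> M \<and> i \<in> e)
      \<in> {f \<in> (\<Pi>\<^sub>E i\<in>V. {e\<in>E. i \<in> e}). \<forall>i\<in>V. \<forall>j\<in>f i. f j = f i}"
    by (simp add: m_def)
qed simp

section \<open>Expectation over independent random edges\<close>

text \<open>The \<open>n\<close>-th moment, up to sign, of a centred Bernoulli variable with parameter \<open>p\<close>.\<close>

definition bernoulli_moment :: "nat \<Rightarrow> real \<Rightarrow> real" where
  "bernoulli_moment n p = p * (p - 1) ^ n + (1 - p) * p ^ n"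

lemma bernoulli_moment_simps [simp]:
  "bernoulli_moment 0 p = 1"
  "bernoulli_moment (Suc 0) p = 0"
  "bernoulli_moment 2 p = p * (1 - p)"
  by (simp_all add: bernoulli_moment_def power2_eq_square algebra_simps)

text \<open>Only the ends of \<open>e\<close> can choose \<open>e\<close>, so the exponent is 0, 1
  or 2, and the moments are 1, 0 and the variance respectively.\<close>

lemma prod_bernoulli_moment_choice:
  assumes G: "finite_simple_graph V E" and f: "f \<in> (\<Pi>\<^sub>E i\<in>V. {e\<in>E. i \<in> e})"
  shows "(\<Prod>e\<in>E. bernoulli_moment (card {i\<in>V. f i = e}) (v e))
       = (if \<forall>i\<in>V. \<forall>j\<in>f i. f j = f i then \<Prod>e\<in>f ` V. v e * (1 - v e) else 0)"
proof -
  have fi: "f i \<in> E" "i \<in> f i" if "i \<in> V" for i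
    using f that by auto
  have sub: "{i\<in>V. f i = e} \<subseteq> e" for e
    using fi by auto
  show ?thesis
  proof (cases "\<forall>i\<in>V. \<forall>j\<in>f i. f j = f i")
    case True
    have "(\<Prod>e\<in>E. bernoulli_moment (card {i\<in>V. f i = e}) (v e))
        = (\<Prod>e\<in>f ` V. bernoulli_moment (card {i\<in>V. f i = e}) (v e))"
    proof (rule prod.mono_neutral_right[OF finite_edges[OF G]])
      show "\<forall>e\<in>E - f ` V. bernoulli_moment (card {i\<in>V. f i = e}) (v e) = 1"
      proof
        fix e assume "e \<in> E - f ` V"
        hence "{i\<in>V. f i = e} = {}" by auto
        thus "bernoulli_moment (card {i\<in>V. f i = e}) (v e) = 1" by (simp only: card.empty) simp
      qed
    qed (use fi in auto)
    also have "\<dots> = (\<Prod>e\<in>f ` V. v e * (1 - v e))"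
    proof (rule prod.cong[OF refl])
      fix e assume e: "e \<in> f ` V"
      hence eE: "e \<in> E" using fi by auto
      have "{i\<in>V. f i = e} = e"
        using sub e True edge_subset[OF G eE] by blast
      thus "bernoulli_moment (card {i\<in>V. f i = e}) (v e) = v e * (1 - v e)"
        using card_edge[OF G eE] by simp
    qed
    finally show ?thesis using True by simp
  next
    case False
    then obtain i j where ij: "i \<in> V" "j \<in> f i" "f j \<noteq> f i" by auto
    \<comment> \<open>The fibre over \<open>f i\<close> contains \<open>i\<close> but misses the
      other end \<open>j\<close>, so it has exactly one element and the first moment kills the
      product.\<close>
    have "{k\<in>V. f k = f i} \<subset> f i" using sub ij by auto
    hence "card {k\<in>V. f k = f i} < 2"
      using psubset_card_mono[OF finite_edge[OF G]] card_edge[OF G] fi(1)[OF ij(1)] by metis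
    moreover have "card {k\<in>V. f k = f i} \<noteq> 0"
      using ij(1) finite_vertices[OF G] by auto
    ultimately have "card {k\<in>V. f k = f i} = Suc 0" by linarith
    hence "bernoulli_moment (card {k\<in>V. f k = f i}) (v (f i)) = 0" by simp
    hence "(\<Prod>e\<in>E. bernoulli_moment (card {i\<in>V. f i = e}) (v e)) = 0"
      using fi(1)[OF ij(1)] finite_edges[OF G] by (intro prod_zero) auto
    thus ?thesis by (simp only: False if_False)
  qed
qed

lemma expected_vertex_product:
  fixes v :: "'a set \<Rightarrow> real"
  assumes G: "finite_simple_graph V E"
    and sum1: "\<And>i. i \<in> V \<Longrightarrow> (\<Sum>e\<in>{e\<in>E. i \<in> e}. v e) = 1"
  shows "(\<Sum>s\<in>Pow E. (\<Prod>i\<in>V. 1 - real (degree_in s i)) * (\<Prod>e\<in>E. if e \<in> s then v e else 1 - v e))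
       = (\<Sum>M\<in>{M. perfect_matching V E M}. \<Prod>e\<in>M. v e * (1 - v e))"
proof -
  note fin = finite_vertices[OF G] finite_edges[OF G]
  let ?I = "\<lambda>i. {e\<in>E. i \<in> e}"
  let ?x = "\<lambda>s e. v e - of_bool (e \<in> s)"
  let ?n = "\<lambda>f e. card {i\<in>V. f i = e}"
  let ?F = "\<Pi>\<^sub>E i\<in>V. ?I i"
  have finF: "finite ?F" using fin by (intro finite_PiE) auto
  have expand: "(\<Prod>i\<in>V. 1 - real (degree_in s i)) = (\<Sum>f\<in>?F. \<Prod>e\<in>E. ?x s e ^ ?n f e)"
    if s: "s \<subseteq> E" for s
  proof -
    \<comment> \<open>The constant 1 is replaced by the sum of \<open>v\<close> around
      \<open>i\<close>, which centres each edge indicator.\<close>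
    have deg: "1 - real (degree_in s i) = (\<Sum>e\<in>?I i. ?x s e)" if "i \<in> V" for i
    proof -
      have "{e\<in>E. i \<in> e} \<inter> {e. e \<in> s} = {e\<in>s. i \<in> e}" using s by auto
      hence "(\<Sum>e\<in>?I i. of_bool (e \<in> s)) = real (degree_in s i)"
        using fin by (simp add: degree_in_def sum_of_bool_eq)
      thus ?thesis by (simp add: sum_subtractf sum1[OF that])
    qed
    have "(\<Prod>i\<in>V. 1 - real (degree_in s i)) = (\<Prod>i\<in>V. \<Sum>e\<in>?I i. ?x s e)"
      using deg by (intro prod.cong) auto
    also have "\<dots> = (\<Sum>f\<in>?F. \<Prod>i\<in>V. ?x s (f i))"
      using fin by (intro prod_sum_PiE) auto
    also have "\<dots> = (\<Sum>f\<in>?F. \<Prod>e\<in>E. ?x s e ^ ?n f e)"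
    proof (rule sum.cong[OF refl])
      fix f assume "f \<in> ?F"
      hence "f ` V \<subseteq> E" by auto
      \<comment> \<open>Grouping the vertices by their chosen edge turns the vertex product into
        powers of the edge variables.\<close>
      from prod.group[OF fin this, of "\<lambda>i. ?x s (f i)", symmetric]
      have "(\<Prod>i\<in>V. ?x s (f i)) = (\<Prod>e\<in>E. \<Prod>i\<in>{i\<in>V. f i = e}. ?x s (f i))" .
      also have "\<dots> = (\<Prod>e\<in>E. \<Prod>i\<in>{i\<in>V. f i = e}. ?x s e)"
        by (intro prod.cong) auto
      finally show "(\<Prod>i\<in>V. ?x s (f i)) = (\<Prod>e\<in>E. ?x s e ^ ?n f e)"
        by (simp only: prod_constant)
    qed
    finally show ?thesis .
  qed
  have "(\<Sum>s\<in>Pow E. (\<Prod>i\<in>V. 1 - real (degree_in s i)) * (\<Prod>e\<in>E. if e \<in> s then v e else 1 - v e))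
      = (\<Sum>s\<in>Pow E. \<Sum>f\<in>?F. \<Prod>e\<in>E. if e \<in> s then v e * (v e - 1) ^ ?n f e
           else (1 - v e) * v e ^ ?n f e)"
  proof (rule sum.cong[OF refl])
    fix s assume "s \<in> Pow E"
    hence "s \<subseteq> E" by simp
    show "(\<Prod>i\<in>V. 1 - real (degree_in s i)) * (\<Prod>e\<in>E. if e \<in> s then v e else 1 - v e)
        = (\<Sum>f\<in>?F. \<Prod>e\<in>E. if e \<in> s then v e * (v e - 1) ^ ?n f e
            else (1 - v e) * v e ^ ?n f e)"
      unfolding expand[OF \<open>s \<subseteq> E\<close>] sum_distrib_right prod.distrib[symmetric]
      by (intro sum.cong prod.cong refl) simp
  qed
  \<comment> \<open>For a fixed choice \<open>f\<close>, the sum over \<open>s\<close> is an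
    expectation of a product of independent edge terms.\<close>
  also have "\<dots> = (\<Sum>f\<in>?F. \<Prod>e\<in>E. bernoulli_moment (?n f e) (v e))"
    by (subst sum.swap) (simp add: sum_Pow_prod_add[OF fin(2)] bernoulli_moment_def)
  also have "\<dots> = (\<Sum>f\<in>?F. if \<forall>i\<in>V. \<forall>j\<in>f i. f j = f i then \<Prod>e\<in>f ` V. v e * (1 - v e) else 0)"
    by (intro sum.cong refl prod_bernoulli_moment_choice[OF G])
  also have "\<dots> = (\<Sum>f\<in>{f \<in> ?F. \<forall>i\<in>V. \<forall>j\<in>f i. f j = f i}. \<Prod>e\<in>f ` V. v e * (1 - v e))"
    using finF by (rule sum.inter_filter[symmetric])
  also have "\<dots> = (\<Sum>M\<in>{M. perfect_matching V E M}. \<Prod>e\<in>M. v e * (1 - v e))"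
    by (rule perfect_matching_choice_bij[OF G])
  finally show ?thesis .
qed

text \<open>The prefactor clears the denominators: an edge of \<open>s\<close> keeps
  \<open>v e\<close>, any other edge keeps \<open>1 - v e\<close>. The cancellation relies on
  \<open>ne1\<close>.\<close>

lemma loop_sum_eq_matching_sum:
  assumes G: "finite_simple_graph V E"
    and sum1: "\<And>i. i \<in> V \<Longrightarrow> (\<Sum>e\<in>{e\<in>E. i \<in> e}. v e) = 1"
    and ne1: "\<And>e. e \<in> E \<Longrightarrow> v e \<noteq> 1"
  shows "(\<Prod>e\<in>E. 1 - v e) * loop_sum V E v
       = (\<Sum>M\<in>{M. perfect_matching V E M}. \<Prod>e\<in>M. v e * (1 - v e))"
proof -
  have "(\<Prod>e\<in>E. 1 - v e) * (\<Prod>e\<in>s. v e / (1 - v e)) = (\<Prod>e\<in>E. if e \<in> s then v e else 1 - v e)"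
    if "s \<subseteq> E" for s
  proof -
    have "(\<Prod>e\<in>s. v e / (1 - v e)) = (\<Prod>e\<in>E. if e \<in> s then v e / (1 - v e) else 1)"
      using that finite_edges[OF G] by (simp add: prod.If_cases Int_absorb1)
    hence "(\<Prod>e\<in>E. 1 - v e) * (\<Prod>e\<in>s. v e / (1 - v e))
        = (\<Prod>e\<in>E. (1 - v e) * (if e \<in> s then v e / (1 - v e) else 1))"
      by (simp only: prod.distrib)
    also have "\<dots> = (\<Prod>e\<in>E. if e \<in> s then v e else 1 - v e)"
      using ne1 by (intro prod.cong refl) simp
    finally show ?thesis .
  qed
  hence "(\<Prod>e\<in>E. 1 - v e) * loop_sum V E v = (\<Sum>s\<in>Pow E.
      (\<Prod>i\<in>V. 1 - real (degree_in s i)) * (\<Prod>e\<in>E. if e \<in> s then v e else 1 - v e))"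
    unfolding loop_sum_def sum_distrib_left
    by (intro sum.cong refl) (simp add: mult.left_commute)
  thus ?thesis
    using expected_vertex_product[OF G sum1] by simp
qed

section \<open>Values of the Bethe approximation\<close>

lemma Z_B_real:
  assumes "\<And>e. e \<in> E \<Longrightarrow> w e \<noteq> 0"
  shows "Z_B E w v
    = ereal (exp (\<Sum>e\<in>E. v e * ln (w e) - v e * ln (v e) + (1 - v e) * ln (1 - v e)))"
proof -
  have "(\<Sum>e\<in>E. ereal (v e) * log_ext (w e)) = ereal (\<Sum>e\<in>E. v e * ln (w e))"
    unfolding sum_ereal[symmetric] using assms by (intro sum.cong) (auto simp: log_ext_def)
  hence "- bethe_free_energy E w v
      = ereal (\<Sum>e\<in>E. v e * ln (w e) - v e * ln (v e) + (1 - v e) * ln (1 - v e))"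
    by (simp add: bethe_free_energy_def sum_subtractf sum.distrib)
  thus ?thesis by (simp add: Z_B_def exp_ext_def)
qed

text \<open>One term of the energy sum is \<open>-\<infinity>\<close>. Nonnegativity of
  \<open>v\<close> excludes terms equal to \<open>\<infinity>\<close>, which would absorb it in
  \<open>ereal\<close> addition. Hence the free energy is \<open>\<infinity>\<close>.\<close>

lemma Z_B_zero:
  assumes fin: "finite E" and e: "e \<in> E" "w e = 0" "v e > 0"
    and pos: "\<And>e. e \<in> E \<Longrightarrow> v e \<ge> 0"
  shows "Z_B E w v = 0"
proof -
  let ?t = "\<lambda>e. ereal (v e) * log_ext (w e)"
  have "?t e = -\<infinity>" using e by (simp add: log_ext_def)
  moreover have "?t a \<noteq> \<infinity>" if "a \<in> E" for a
    using pos[OF that] by (auto simp: log_ext_def)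
  ultimately have "(\<Sum>e\<in>E. ?t e) = -\<infinity>"
    using fin e(1) by (subst sum.remove[of _ e]) (auto simp: sum_Pinfty)
  thus ?thesis by (simp add: Z_B_def bethe_free_energy_def exp_ext_def)
qed

section \<open>The loop series identity\<close>

theorem theorem6p6:
  fixes V :: "'a set" and E :: "'a set set" and w v :: "'a set \<Rightarrow> real"
  assumes "finite_simple_graph V E"
    and "\<And>e. e \<in> E \<Longrightarrow> w e \<ge> 0"
    and "LBP_solution V E w v"
  shows "ereal (partition_function V E w) = Z_B E w v * ereal (loop_sum V E v)"
proof -
  note G = assms(1)
  note fin = finite_edges[OF G]
  have vpos: "v e > 0" if "e \<in> E" for e
    using assms(3) that by (auto simp: LBP_solution_def L'_def)
  have sum1: "(\<Sum>e\<in>{e\<in>E. i \<in> e}. v e) = 1" if "i \<in> V" for i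
    using assms(3) that sum_neighbours[OF G, of v i] by (auto simp: LBP_solution_def L'_def)
  obtain \<mu> where \<mu>: "v e * (1 - v e) = w e * exp (\<Sum>i\<in>e. \<mu> i)" if "e \<in> E" for e
  proof -
    obtain \<mu> where mu: "\<And>i j. {i, j} \<in> E \<Longrightarrow>
        v {i, j} * (1 - v {i, j}) = w {i, j} * exp (\<mu> i + \<mu> j)"
      using assms(3) unfolding LBP_solution_def by blast
    have "v e * (1 - v e) = w e * exp (\<Sum>i\<in>e. \<mu> i)" if e: "e \<in> E" for e
    proof -
      obtain i j where "e = {i, j}" "i \<noteq> j"
        using card_edge[OF G e] by (auto simp: card_2_iff)
      thus ?thesis using mu[of i j] e by simp
    qed
    thus ?thesis by (rule that)
  qed
  show ?thesis
  proof (cases "\<exists>e\<in>E. w e = 0")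
    case True
    then obtain e where e: "e \<in> E" "w e = 0" by auto
    have ve: "v e = 1" using \<mu>[OF e(1)] e vpos[OF e(1)] by simp
    obtain i where i: "i \<in> e" "i \<in> V"
      using card_edge[OF G e(1)] edge_subset[OF G e(1)] by (auto simp: card_2_iff)
    \<comment> \<open>The edge \<open>e\<close> already exhausts the unit sum at \<open>i\<close>,
      and all values of \<open>v\<close> on edges are positive. Hence every perfect matching must
      use \<open>e\<close> to cover \<open>i\<close>, and both sides vanish.\<close>
    have only: "e' = e" if e': "e' \<in> E" "i \<in> e'" for e'
    proof (rule ccontr)
      assume "e' \<noteq> e"
      hence "v e + v e' = (\<Sum>e\<in>{e, e'}. v e)" by simp
      also have "\<dots> \<le> (\<Sum>e\<in>{e\<in>E. i \<in> e}. v e)"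
        using fin e e' i vpos by (intro sum_mono2) (auto intro: less_imp_le)
      finally show False using ve sum1[OF i(2)] vpos[OF e'(1)] by simp
    qed
    have "(\<Prod>e\<in>M. w e) = 0" if "perfect_matching V E M" for M
    proof -
      have "e \<in> M" using that i only unfolding perfect_matching_def by (metis subsetD)
      moreover have "finite M"
        using that fin finite_subset by (auto simp: perfect_matching_def)
      ultimately show ?thesis using e by (intro prod_zero) auto
    qed
    hence "partition_function V E w = 0" by (simp add: partition_function_def)
    moreover have "Z_B E w v = 0"
      using fin e vpos by (intro Z_B_zero[of E e]) (auto intro: less_imp_le)
    ultimately show ?thesis by (simp add: zero_ereal_def[symmetric])
  next
    case False
    hence wpos: "w e > 0" if "e \<in> E" for e
      using assms(2) that by (metis order_less_le)
    have v1: "v e < 1" if "e \<in> E" for e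
    proof -
      have "v e * (1 - v e) > 0" using \<mu>[OF that] wpos[OF that] by simp
      thus ?thesis using vpos[OF that] by (simp add: zero_less_mult_iff)
    qed
    \<comment> \<open>The factor \<open>exp (- ?S)\<close> appears both in \<open>Z_B\<close> and in
      the weight of every perfect matching, so the multipliers \<open>\<mu>\<close> drop out of the
      identity.\<close>
    let ?S = "\<Sum>i\<in>V. \<mu> i"
    have lnw: "ln (w e) = ln (v e) + ln (1 - v e) - (\<Sum>i\<in>e. \<mu> i)" if e: "e \<in> E" for e
    proof -
      have "ln (v e * (1 - v e)) = ln (w e * exp (\<Sum>i\<in>e. \<mu> i))" using \<mu>[OF e] by simp
      thus ?thesis using vpos[OF e] v1[OF e] wpos[OF e] by (simp add: ln_mult)
    qed
    \<comment> \<open>Substituting \<open>lnw\<close> cancels \<open>v e * ln (v e)\<close>, and the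
      two multiples of \<open>ln (1 - v e)\<close> have coefficients adding to one.\<close>
    have "(\<Sum>e\<in>E. v e * ln (w e) - v e * ln (v e) + (1 - v e) * ln (1 - v e))
        = (\<Sum>e\<in>E. ln (1 - v e) - v e * (\<Sum>i\<in>e. \<mu> i))"
      by (intro sum.cong refl) (simp add: lnw algebra_simps)
    also have "\<dots> = (\<Sum>e\<in>E. ln (1 - v e)) - ?S"
      by (simp add: sum_subtractf sum_edges_vertices_swap[OF G] sum1)
    finally have Z: "Z_B E w v = ereal ((\<Prod>e\<in>E. 1 - v e) * exp (- ?S))"
      using Z_B_real[of E w v] wpos v1 fin
      by (simp add: exp_diff exp_minus exp_sum divide_inverse less_imp_neq[symmetric])
    have "(\<Prod>e\<in>M. w e) = exp (- ?S) * (\<Prod>e\<in>M. v e * (1 - v e))" if M: "perfect_matching V E M" for M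
    proof -
      have ME: "M \<subseteq> E" using M by (simp add: perfect_matching_def)
      hence "finite M" using fin finite_subset by blast
      have "(\<Prod>e\<in>M. v e * (1 - v e)) = (\<Prod>e\<in>M. w e * exp (\<Sum>i\<in>e. \<mu> i))"
        using \<mu> ME by (intro prod.cong) auto
      also have "\<dots> = (\<Prod>e\<in>M. w e) * exp ?S"
        by (simp add: prod.distrib exp_sum[OF \<open>finite M\<close>, symmetric] sum_perfect_matching[OF G M])
      finally show ?thesis by (simp add: exp_minus)
    qed
    hence "partition_function V E w
        = exp (- ?S) * (\<Sum>M\<in>{M. perfect_matching V E M}. \<Prod>e\<in>M. v e * (1 - v e))"
      by (simp add: partition_function_def sum_distrib_left)
    also have "\<dots> = exp (- ?S) * ((\<Prod>e\<in>E. 1 - v e) * loop_sum V E v)"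
      using loop_sum_eq_matching_sum[OF G sum1] v1 by (simp add: less_imp_neq)
    finally show ?thesis unfolding Z by (simp add: mult_ac)
  qed
qed

end
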